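(* Let $f(\eta,\theta,\xi)$, $(\eta,\theta,\xi)\in[0,\infty)\times[-\pi,\pi)\times[-\pi,\pi)$, be the (bounded) solution of the Milne problem $$\sin(\theta+\xi)\frac{\partial f}{\partial\eta}+f-\bar f=0,\qquad f(0,\theta,\xi)=g(\theta,\xi)\ \text{ for }\sin(\theta+\xi)>0,\qquad\lim_{\eta\to\infty}f(\eta,\theta,\xi)=f(\infty,\theta).$$ If $g(\theta,\xi)=\cos(3(\theta+\xi))$, then $$\frac{\partial f}{\partial\eta}\notin L^\infty([0,\infty)\times[-\pi,\pi)\times[-\pi,\pi)).$$
   Context: Here $\bar f(\eta,\theta)=\frac1{2\pi}\int_{-\pi}^{\pi}f(\eta,\theta,\xi)\,d\xi$. The limit $f(\infty,\theta)$ is part of the unknown (it is not prescribed). The problem has a unique solution $f\in L^\infty$. *)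

theory Defs
  imports "HOL-Analysis.Analysis"
begin

definition Linfty_on :: "'a::euclidean_space set \<Rightarrow> ('a \<Rightarrow> real) \<Rightarrow> bool" where
  "Linfty_on S h \<longleftrightarrow>
     h \<in> borel_measurable (lebesgue_on S) \<and> (\<exists>C. AE x in lebesgue_on S. \<bar>h x\<bar> \<le> C)"

abbreviation angles :: "(real \<times> real) set" where
  "angles \<equiv> {-pi..<pi} \<times> {-pi..<pi}"

abbreviation phase_space :: "(real \<times> real \<times> real) set" where
  "phase_space \<equiv> {0..} \<times> angles"

definition velocity_average :: "(real \<Rightarrow> real \<Rightarrow> real \<Rightarrow> real) \<Rightarrow> real \<Rightarrow> real \<Rightarrow> real" where
  "velocity_average f \<eta> \<theta> = 1 / (2 * pi) * (LINT \<xi>:{-pi..<pi}|lebesgue. f \<eta> \<theta> \<xi>)"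

definition d_eta :: "(real \<Rightarrow> real \<Rightarrow> real \<Rightarrow> real) \<Rightarrow> real \<Rightarrow> real \<Rightarrow> real \<Rightarrow> real" where
  "d_eta f \<eta> \<theta> \<xi> = deriv (\<lambda>s. f s \<theta> \<xi>) \<eta>"

text \<open>
  Solutions are elements of L-infinity, so the conditions are imposed along almost every line
  (\<theta>, \<xi>) = const; in particular nothing is asked on the null set sin (\<theta> + \<xi>) = 0, where f need
  not be differentiable. Continuity up to \<eta> = 0 gives a meaning to the boundary values.
  Every bounded weak solution has such a representative: off that null set it is Lipschitz in \<eta>,
  hence its average is continuous in \<eta>, hence it is continuously differentiable in \<eta>.
  The limit at infinity is an unknown of the problem, independent of \<xi>.
\<close>

definition milne_solution ::
    "(real \<Rightarrow> real \<Rightarrow> real) \<Rightarrow> (real \<Rightarrow> real \<Rightarrow> real \<Rightarrow> real) \<Rightarrow> bool" where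
  "milne_solution g f \<longleftrightarrow>
     Linfty_on phase_space (\<lambda>(\<eta>, \<theta>, \<xi>). f \<eta> \<theta> \<xi>) \<and>
     (AE (\<theta>, \<xi>) in lebesgue_on angles.
        continuous_on {0..} (\<lambda>\<eta>. f \<eta> \<theta> \<xi>) \<and>
        (\<forall>\<eta>>0. (\<lambda>s. f s \<theta> \<xi>) differentiable (at \<eta>) \<and>
           sin (\<theta> + \<xi>) * d_eta f \<eta> \<theta> \<xi> + f \<eta> \<theta> \<xi> - velocity_average f \<eta> \<theta> = 0)) \<and>
     (AE (\<theta>, \<xi>) in lebesgue_on angles. sin (\<theta> + \<xi>) > 0 \<longrightarrow> f 0 \<theta> \<xi> = g \<theta> \<xi>) \<and>
     (\<exists>f_inf :: real \<Rightarrow> real. AE (\<theta>, \<xi>) in lebesgue_on angles.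
        ((\<lambda>\<eta>. f \<eta> \<theta> \<xi>) \<longlongrightarrow> f_inf \<theta>) at_top)"

end

theory Submission imports Defs begin

text \<open>
  The obstruction to a bounded normal derivative comes from the two grazing directions
  \<open>\<theta> + \<xi> = 0\<close> and \<open>\<theta> + \<xi> = \<pi>\<close>, where the transport coefficient \<open>sin (\<theta> + \<xi>)\<close> vanishes.
  If \<open>\<bar>\<partial>f/\<partial>\<eta>\<bar> \<le> C\<close>, the equation gives \<open>\<bar>f - \<langle>f\<rangle>\<bar> \<le> C \<bar>sin (\<theta> + \<xi>)\<bar>\<close>, where the average \<open>\<langle>f\<rangle>\<close>
  does not depend on \<open>\<xi>\<close>. Near both grazing directions \<open>f\<close> is thus forced towards one and the same
  number; eliminating this number and letting \<open>\<eta> \<rightarrow> 0\<close> yields \<open>inflow_data_oscillation_bound\<close>, an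
  estimate on the inflow data alone. But \<open>cos (3 (\<theta> + \<xi>))\<close> tends to \<open>1\<close> at the first grazing
  direction and to \<open>-1\<close> at the second one.

  The derivative bound is only known almost everywhere in phase space and says nothing about the
  null set \<open>\<eta> = 0\<close>. So the wall is approached along a sequence of heights \<open>\<eta>\<^sub>n \<rightarrow> 0\<close> at each of
  which the bound holds for almost every direction. As the sequence is countable, almost every
  direction is good at all heights simultaneously, and along such a direction the continuity of
  \<open>f\<close> in \<open>\<eta>\<close> gives the limit.
\<close>

lemma AE_lborel_obtain_in_interval:
  fixes a b :: real
  assumes "AE x in lborel. P x" and "a < b"
  obtains x where "a < x" "x < b" "P x"
proof -
  have "\<exists>x\<in>{a<..<b}. P x"
  proof (rule ccontr)
    assume "\<not> (\<exists>x\<in>{a<..<b}. P x)"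
    with assms(1) have "AE x in lborel. x \<notin> {a<..<b}"
      by (auto elim: eventually_mono)
    then have "emeasure lborel {a<..<b} = 0"
      by (subst (asm) AE_iff_measurable) auto
    with \<open>a < b\<close> show False by simp
  qed
  with that show thesis by auto
qed

lemma AE_lebesgue_on_iff_AE_lborel:
  assumes "S \<in> sets lebesgue"
  shows "(AE x in lebesgue_on S. P x) \<longleftrightarrow> (AE x in lborel. x \<in> S \<longrightarrow> P x)"
  using assms by (simp add: AE_restrict_space_iff AE_completion_iff)

lemma AE_lborel_sections:
  fixes P :: "'a::euclidean_space \<times> 'b::euclidean_space \<Rightarrow> bool"
  assumes "AE p in lborel. P p"
  shows "AE x in lborel. AE y in lborel. P (x, y)"
proof -
  have "AE p in lborel \<Otimes>\<^sub>M lborel. P p"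
    using assms unfolding lborel_prod .
  then show ?thesis
    by (rule lborel_pair.AE_pair)
qed

lemma sets_lebesgue_angles: "angles \<in> sets lebesgue"
  by (intro sets_completionI_sets) (simp flip: borel_prod)

lemma sets_lebesgue_phase_space: "phase_space \<in> sets lebesgue"
  by (intro sets_completionI_sets) (simp flip: borel_prod)

text \<open>
  Fubini is applied with \<open>\<eta>\<close> as the outer variable; this is what allows a single sequence of
  heights to serve almost every direction.
\<close>
lemma bounded_along_heights_to_wall:
  assumes "Linfty_on phase_space (\<lambda>(\<eta>, \<theta>, \<xi>). h \<eta> \<theta> \<xi>)"
  obtains C H where "C \<ge> 0" "\<And>n. H n > 0" "H \<longlonglongrightarrow> 0"
    "AE (\<theta>, \<xi>) in lborel. (\<theta>, \<xi>) \<in> angles \<longrightarrow> (\<forall>n::nat. \<bar>h (H n) \<theta> \<xi>\<bar> \<le> C)"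
proof -
  from assms obtain K where
    "AE (\<eta>, \<theta>, \<xi>) in lebesgue_on phase_space. \<bar>h \<eta> \<theta> \<xi>\<bar> \<le> K"
    by (auto simp: Linfty_on_def case_prod_unfold)
  then have "AE x in lborel. x \<in> phase_space \<longrightarrow> (case x of (\<eta>, \<theta>, \<xi>) \<Rightarrow> \<bar>h \<eta> \<theta> \<xi>\<bar> \<le> K)"
    by (simp add: AE_lebesgue_on_iff_AE_lborel[OF sets_lebesgue_phase_space])
  from AE_lborel_sections[OF this]
  have ae: "AE \<eta> in lborel. AE (\<theta>, \<xi>) in lborel.
      \<eta> \<ge> 0 \<longrightarrow> (\<theta>, \<xi>) \<in> angles \<longrightarrow> \<bar>h \<eta> \<theta> \<xi>\<bar> \<le> \<bar>K\<bar>"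
  proof (rule eventually_mono)
    fix \<eta>
    assume "AE y in lborel. (\<eta>, y) \<in> phase_space \<longrightarrow>
      (case (\<eta>, y) of (\<eta>, \<theta>, \<xi>) \<Rightarrow> \<bar>h \<eta> \<theta> \<xi>\<bar> \<le> K)"
    then show "AE (\<theta>, \<xi>) in lborel. \<eta> \<ge> 0 \<longrightarrow> (\<theta>, \<xi>) \<in> angles \<longrightarrow> \<bar>h \<eta> \<theta> \<xi>\<bar> \<le> \<bar>K\<bar>"
      by (rule eventually_mono) auto
  qed
  define bdd_at where
    "bdd_at \<eta> \<longleftrightarrow> (AE (\<theta>, \<xi>) in lborel. (\<theta>, \<xi>) \<in> angles \<longrightarrow> \<bar>h \<eta> \<theta> \<xi>\<bar> \<le> \<bar>K\<bar>)" for \<eta>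
  have "\<exists>\<eta>. 0 < \<eta> \<and> \<eta> < inverse (real (Suc n)) \<and> bdd_at \<eta>" for n
    by (rule AE_lborel_obtain_in_interval[OF ae, of 0 "inverse (real (Suc n))"])
      (auto simp: bdd_at_def)
  then obtain H where H: "\<And>n. 0 < H n" "\<And>n. H n < inverse (real (Suc n))" "\<And>n. bdd_at (H n)"
    by metis
  have "H \<longlonglongrightarrow> 0"
    by (rule tendsto_sandwich[OF _ _ tendsto_const LIMSEQ_inverse_real_of_nat])
      (intro always_eventually allI less_imp_le H)+
  moreover have "AE (\<theta>, \<xi>) in lborel. (\<theta>, \<xi>) \<in> angles \<longrightarrow> (\<forall>n. \<bar>h (H n) \<theta> \<xi>\<bar> \<le> \<bar>K\<bar>)"
  proof -
    have "AE p in lborel. \<forall>n. case p of (\<theta>, \<xi>) \<Rightarrow> (\<theta>, \<xi>) \<in> angles \<longrightarrow> \<bar>h (H n) \<theta> \<xi>\<bar> \<le> \<bar>K\<bar>"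
      using H(3) by (simp add: AE_all_countable bdd_at_def)
    then show ?thesis
      by (rule eventually_mono) auto
  qed
  ultimately show thesis
    by (rule that[OF abs_ge_zero H(1)])
qed

text \<open>
  Two directions with the same \<open>\<theta>\<close> share the same average, so at every height \<open>\<eta>\<^sub>n\<close> the
  values of \<open>f\<close> in these directions differ by at most the sum of their distances to the average.
  Letting \<open>\<eta>\<^sub>n \<rightarrow> 0\<close> replaces these values by the inflow data.
\<close>
lemma inflow_data_oscillation_bound:
  assumes sol: "milne_solution g f"
    and bdd: "Linfty_on phase_space (\<lambda>(\<eta>, \<theta>, \<xi>). d_eta f \<eta> \<theta> \<xi>)"
  obtains C where "C \<ge> 0" "AE \<theta> in lborel. AE \<xi> in lborel. AE \<zeta> in lborel.
    (\<theta>, \<xi>) \<in> angles \<and> (\<theta>, \<zeta>) \<in> angles \<and> sin (\<theta> + \<xi>) > 0 \<and> sin (\<theta> + \<zeta>) > 0 \<longrightarrow>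
      \<bar>g \<theta> \<xi> - g \<theta> \<zeta>\<bar> \<le> C * (sin (\<theta> + \<xi>) + sin (\<theta> + \<zeta>))"
proof -
  obtain C H where C: "C \<ge> 0" and H: "\<And>n. H n > 0" "H \<longlonglongrightarrow> 0"
    and ae_bdd: "AE (\<theta>, \<xi>) in lborel. (\<theta>, \<xi>) \<in> angles \<longrightarrow> (\<forall>n::nat. \<bar>d_eta f (H n) \<theta> \<xi>\<bar> \<le> C)"
    using bounded_along_heights_to_wall[OF bdd] by blast
  define good where "good = (\<lambda>\<theta> \<xi>. (\<theta>, \<xi>) \<in> angles \<longrightarrow> sin (\<theta> + \<xi>) > 0 \<longrightarrow>
      (\<lambda>n. f (H n) \<theta> \<xi>) \<longlonglongrightarrow> g \<theta> \<xi> \<and>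
      (\<forall>n. \<bar>f (H n) \<theta> \<xi> - velocity_average f (H n) \<theta>\<bar> \<le> C * sin (\<theta> + \<xi>)))"
  from sol have
    "AE (\<theta>, \<xi>) in lebesgue_on angles. continuous_on {0..} (\<lambda>\<eta>. f \<eta> \<theta> \<xi>) \<and>
        (\<forall>\<eta>>0. (\<lambda>s. f s \<theta> \<xi>) differentiable (at \<eta>) \<and>
           sin (\<theta> + \<xi>) * d_eta f \<eta> \<theta> \<xi> + f \<eta> \<theta> \<xi> - velocity_average f \<eta> \<theta> = 0)"
    and "AE (\<theta>, \<xi>) in lebesgue_on angles. sin (\<theta> + \<xi>) > 0 \<longrightarrow> f 0 \<theta> \<xi> = g \<theta> \<xi>"
    unfolding milne_solution_def by blast+
  note sol_lborel = this[unfolded AE_lebesgue_on_iff_AE_lborel[OF sets_lebesgue_angles]]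
  have eqn: "AE (\<theta>, \<xi>) in lborel. (\<theta>, \<xi>) \<in> angles \<longrightarrow> continuous_on {0..} (\<lambda>\<eta>. f \<eta> \<theta> \<xi>) \<and>
        (\<forall>\<eta>>0. sin (\<theta> + \<xi>) * d_eta f \<eta> \<theta> \<xi> + f \<eta> \<theta> \<xi> - velocity_average f \<eta> \<theta> = 0)"
    using sol_lborel(1) by (rule eventually_mono) auto
  have inflow: "AE (\<theta>, \<xi>) in lborel. (\<theta>, \<xi>) \<in> angles \<longrightarrow> sin (\<theta> + \<xi>) > 0 \<longrightarrow> f 0 \<theta> \<xi> = g \<theta> \<xi>"
    using sol_lborel(2) by (rule eventually_mono) auto
  have "AE p in lborel. good (fst p) (snd p)"
    using ae_bdd eqn inflow
  proof eventually_elim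
    case (elim p)
    obtain \<theta> \<xi> where p: "p = (\<theta>, \<xi>)" by (cases p)
    show ?case
      unfolding good_def p fst_conv snd_conv
    proof (intro impI conjI allI)
      assume ang: "(\<theta>, \<xi>) \<in> angles" and pos: "sin (\<theta> + \<xi>) > 0"
      have "(\<lambda>n. f (H n) \<theta> \<xi>) \<longlonglongrightarrow> f 0 \<theta> \<xi>"
        using elim(2) ang H
        by (intro continuous_on_tendsto_compose[where f = "\<lambda>\<eta>. f \<eta> \<theta> \<xi>" and s = "{0..}"])
          (auto simp: p intro!: less_imp_le always_eventually)
      with elim(3) ang pos show "(\<lambda>n. f (H n) \<theta> \<xi>) \<longlonglongrightarrow> g \<theta> \<xi>"
        by (simp add: p)
      fix n
      have "f (H n) \<theta> \<xi> - velocity_average f (H n) \<theta> = - (sin (\<theta> + \<xi>) * d_eta f (H n) \<theta> \<xi>)"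
        using elim(2) ang H(1)[of n] by (simp add: p algebra_simps add_eq_0_iff)
      moreover have "\<bar>d_eta f (H n) \<theta> \<xi>\<bar> \<le> C"
        using elim(1) ang by (simp add: p)
      ultimately show "\<bar>f (H n) \<theta> \<xi> - velocity_average f (H n) \<theta>\<bar> \<le> C * sin (\<theta> + \<xi>)"
        using pos by (simp add: abs_mult mult.commute)
    qed
  qed
  then have ae_good: "AE \<theta> in lborel. AE \<xi> in lborel. good \<theta> \<xi>"
    using AE_lborel_sections[of "\<lambda>p. good (fst p) (snd p)"] by simp
  have bound: "\<bar>g \<theta> \<xi> - g \<theta> \<zeta>\<bar> \<le> C * (sin (\<theta> + \<xi>) + sin (\<theta> + \<zeta>))"
    if good: "good \<theta> \<xi>" "good \<theta> \<zeta>"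
      and dirs: "(\<theta>, \<xi>) \<in> angles" "(\<theta>, \<zeta>) \<in> angles" "sin (\<theta> + \<xi>) > 0" "sin (\<theta> + \<zeta>) > 0"
    for \<theta> \<xi> \<zeta>
  proof (rule tendsto_upperbound)
    show "(\<lambda>n. \<bar>f (H n) \<theta> \<xi> - f (H n) \<theta> \<zeta>\<bar>) \<longlonglongrightarrow> \<bar>g \<theta> \<xi> - g \<theta> \<zeta>\<bar>"
      using good dirs by (intro tendsto_rabs tendsto_diff) (auto simp: good_def)
    have "\<bar>f (H n) \<theta> \<xi> - f (H n) \<theta> \<zeta>\<bar> \<le> C * (sin (\<theta> + \<xi>) + sin (\<theta> + \<zeta>))" for n
    proof -
      have "\<bar>f (H n) \<theta> \<xi> - velocity_average f (H n) \<theta>\<bar> \<le> C * sin (\<theta> + \<xi>)"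
        "\<bar>f (H n) \<theta> \<zeta> - velocity_average f (H n) \<theta>\<bar> \<le> C * sin (\<theta> + \<zeta>)"
        using good dirs by (auto simp: good_def)
      then show ?thesis
        unfolding distrib_left by linarith
    qed
    then show "\<forall>\<^sub>F n in sequentially.
        \<bar>f (H n) \<theta> \<xi> - f (H n) \<theta> \<zeta>\<bar> \<le> C * (sin (\<theta> + \<xi>) + sin (\<theta> + \<zeta>))"
      by simp
  qed simp
  from ae_good have "AE \<theta> in lborel. AE \<xi> in lborel. AE \<zeta> in lborel.
    (\<theta>, \<xi>) \<in> angles \<and> (\<theta>, \<zeta>) \<in> angles \<and> sin (\<theta> + \<xi>) > 0 \<and> sin (\<theta> + \<zeta>) > 0 \<longrightarrow>
      \<bar>g \<theta> \<xi> - g \<theta> \<zeta>\<bar> \<le> C * (sin (\<theta> + \<xi>) + sin (\<theta> + \<zeta>))"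
  proof eventually_elim
    case outer: (elim \<theta>)
    from outer show ?case
    proof eventually_elim
      case inner: (elim \<xi>)
      from outer show ?case
        by eventually_elim (use inner bound in blast)
    qed
  qed
  with C show thesis by (rule that)
qed

theorem lemmaA1:
  fixes f :: "real \<Rightarrow> real \<Rightarrow> real \<Rightarrow> real"
  assumes "milne_solution (\<lambda>\<theta> \<xi>. cos (3 * (\<theta> + \<xi>))) f"
  shows "\<not> Linfty_on phase_space (\<lambda>(\<eta>, \<theta>, \<xi>). d_eta f \<eta> \<theta> \<xi>)"
proof
  assume "Linfty_on phase_space (\<lambda>(\<eta>, \<theta>, \<xi>). d_eta f \<eta> \<theta> \<xi>)"
  then obtain C where C: "C \<ge> 0" and
    osc: "AE \<theta> in lborel. AE \<xi> in lborel. AE \<zeta> in lborel.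
      (\<theta>, \<xi>) \<in> angles \<and> (\<theta>, \<zeta>) \<in> angles \<and> sin (\<theta> + \<xi>) > 0 \<and> sin (\<theta> + \<zeta>) > 0 \<longrightarrow>
      \<bar>cos (3 * (\<theta> + \<xi>)) - cos (3 * (\<theta> + \<zeta>))\<bar> \<le> C * (sin (\<theta> + \<xi>) + sin (\<theta> + \<zeta>))"
    by (rule inflow_data_oscillation_bound[OF assms])
  \<comment> \<open>Within \<open>\<pi>/9\<close> of a grazing direction the datum exceeds \<open>1/2\<close> in modulus, so the oscillation
    exceeds \<open>1\<close>; the second bound on \<open>\<delta>\<close> makes its upper bound \<open>2 C \<delta>\<close> at most \<open>1\<close>.\<close>
  define \<delta> where "\<delta> = min (pi / 9) (1 / (2 * (C + 1)))"
  have \<delta>: "0 < \<delta>" "\<delta> \<le> pi / 9" "2 * (C + 1) * \<delta> \<le> 1"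
  proof -
    show "0 < \<delta>" "\<delta> \<le> pi / 9" using C by (auto simp: \<delta>_def)
    have "\<delta> \<le> 1 / (2 * (C + 1))" by (simp add: \<delta>_def)
    with C show "2 * (C + 1) * \<delta> \<le> 1" by (simp add: field_simps)
  qed
  \<comment> \<open>For \<open>0 < \<theta> < \<pi>\<close> both grazing directions are interior to the range of \<open>\<xi>\<close>.\<close>
  obtain \<theta> where \<theta>: "0 < \<theta>" "\<theta> < pi" and
    osc_\<theta>: "AE \<xi> in lborel. AE \<zeta> in lborel.
      (\<theta>, \<xi>) \<in> angles \<and> (\<theta>, \<zeta>) \<in> angles \<and> sin (\<theta> + \<xi>) > 0 \<and> sin (\<theta> + \<zeta>) > 0 \<longrightarrow>
      \<bar>cos (3 * (\<theta> + \<xi>)) - cos (3 * (\<theta> + \<zeta>))\<bar> \<le> C * (sin (\<theta> + \<xi>) + sin (\<theta> + \<zeta>))"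
    by (rule AE_lborel_obtain_in_interval[OF osc pi_gt_zero])
  obtain \<xi> where \<xi>: "- \<theta> < \<xi>" "\<xi> < - \<theta> + \<delta>" and
    osc_\<xi>: "AE \<zeta> in lborel.
      (\<theta>, \<xi>) \<in> angles \<and> (\<theta>, \<zeta>) \<in> angles \<and> sin (\<theta> + \<xi>) > 0 \<and> sin (\<theta> + \<zeta>) > 0 \<longrightarrow>
      \<bar>cos (3 * (\<theta> + \<xi>)) - cos (3 * (\<theta> + \<zeta>))\<bar> \<le> C * (sin (\<theta> + \<xi>) + sin (\<theta> + \<zeta>))"
    using AE_lborel_obtain_in_interval[OF osc_\<theta>, of "- \<theta>" "- \<theta> + \<delta>"] \<delta>(1) by auto
  obtain \<zeta> where \<zeta>: "pi - \<theta> - \<delta> < \<zeta>" "\<zeta> < pi - \<theta>" and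
    osc_\<zeta>: "(\<theta>, \<xi>) \<in> angles \<and> (\<theta>, \<zeta>) \<in> angles \<and> sin (\<theta> + \<xi>) > 0 \<and> sin (\<theta> + \<zeta>) > 0 \<longrightarrow>
      \<bar>cos (3 * (\<theta> + \<xi>)) - cos (3 * (\<theta> + \<zeta>))\<bar> \<le> C * (sin (\<theta> + \<xi>) + sin (\<theta> + \<zeta>))"
    using AE_lborel_obtain_in_interval[OF osc_\<xi>, of "pi - \<theta> - \<delta>" "pi - \<theta>"] \<delta>(1) by auto
  define \<alpha> where "\<alpha> = \<theta> + \<xi>"
  define \<beta> where "\<beta> = pi - (\<theta> + \<zeta>)"
  have near: "0 < sin \<gamma> \<and> sin \<gamma> \<le> \<delta> \<and> 1 / 2 < cos (3 * \<gamma>)" if "0 < \<gamma>" "\<gamma> < \<delta>" for \<gamma>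
  proof (intro conjI)
    show "0 < sin \<gamma>"
      using that \<delta>(2) by (intro sin_gt_zero) auto
    show "sin \<gamma> \<le> \<delta>"
      using sin_x_le_x[of \<gamma>] that by linarith
    have "cos (pi / 3) < cos (3 * \<gamma>)"
      using that \<delta>(2) by (intro cos_monotone_0_pi) auto
    then show "1 / 2 < cos (3 * \<gamma>)"
      by (simp add: cos_60)
  qed
  have \<alpha>: "0 < sin \<alpha>" "sin \<alpha> \<le> \<delta>" "1 / 2 < cos (3 * \<alpha>)"
    using near[of \<alpha>] \<xi> by (auto simp: \<alpha>_def)
  have \<beta>: "0 < sin \<beta>" "sin \<beta> \<le> \<delta>" "1 / 2 < cos (3 * \<beta>)"
    using near[of \<beta>] \<zeta> by (auto simp: \<beta>_def)
  have sum_\<zeta>: "\<theta> + \<zeta> = pi - \<beta>" by (simp add: \<beta>_def)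
  have sin_\<zeta>: "sin (\<theta> + \<zeta>) = sin \<beta>"
    by (simp add: sum_\<zeta>)
  have cos_\<zeta>: "cos (3 * (\<theta> + \<zeta>)) = - cos (3 * \<beta>)"
  proof -
    have "3 * (\<theta> + \<zeta>) = (pi - 3 * \<beta>) + 2 * pi" by (simp add: sum_\<zeta>)
    then show ?thesis
      by (simp only: cos_periodic cos_pi_minus)
  qed
  have "(\<theta>, \<xi>) \<in> angles" "(\<theta>, \<zeta>) \<in> angles"
    using \<theta> \<xi> \<zeta> \<delta>(2) by auto
  with osc_\<zeta> \<alpha>(1) \<beta>(1) have "\<bar>cos (3 * \<alpha>) + cos (3 * \<beta>)\<bar> \<le> C * (sin \<alpha> + sin \<beta>)"
    by (simp only: sin_\<zeta> cos_\<zeta> flip: \<alpha>_def) simp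
  also have "\<dots> \<le> C * (2 * \<delta>)"
    using C \<alpha>(2) \<beta>(2) by (intro mult_left_mono) auto
  also have "\<dots> \<le> 1"
    using \<delta> by (simp add: algebra_simps)
  finally show False
    using \<alpha>(3) \<beta>(3) by linarith
qed

end
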